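(* Let $q$ be an odd prime power and let $\alpha,\beta\in\mathbb{F}_{q^2}$ with $\alpha\neq 0$ be such that $d=(\beta^q-\beta)^2+4\alpha^{q+1}$ is a nonsquare in $\mathbb{F}_q$, so that $\mathcal U_{\alpha\beta}$ is a non-classical orthogonal Buekenhout–Metz unital in $\mathrm{PG}(2,q^2)$. Let $P$ be a point with $P\notin\mathcal U_{\alpha\beta}\cup\ell_\infty$. Then the points of $\mathrm{pedal}(P)$ lie on the lines of a Baer pencil whose vertex is a point of $\ell_\infty$. Moreover: (1) If $\alpha$ is a nonsquare in $\mathbb{F}_{q^2}$, then $\mathrm{pedal}(P)$ is an arc. (2) If $\alpha$ is a nonzero square in $\mathbb{F}_{q^2}$, then (a) $\mathrm{pedal}(P)$ is a set of class $(0,1,2,4)$; (b) there are at least $\frac{q-3}{4}$ lines meeting $\mathrm{pedal}(P)$ in exactly $4$ points; (c) every line meeting $\mathrm{pedal}(P)$ in exactly $4$ points contains the vertex of the Baer pencil containing $\mathrm{pedal}(P)$.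
   Context: Points of $\mathrm{PG}(2,q^2)$ have homogeneous coordinates $(x,y,z)$ over $\mathbb{F}_{q^2}$; $\ell_\infty$ is the line $z=0$. For $\alpha,\beta\in\mathbb{F}_{q^2}$, $\mathcal U_{\alpha\beta}=\{(x,\alpha x^2+\beta x^{q+1}+r,1): x\in\mathbb{F}_{q^2}, r\in\mathbb{F}_q\}\cup\{(0,1,0)\}$. Under the stated nonsquare condition on $d$, $\mathcal U_{\alpha\beta}$ is a unital (a set of $q^3+1$ points meeting every line in $1$ or $q+1$ points), and $\alpha\neq0$ means it is non-classical. A tangent line is a line meeting the unital in exactly one point. For a point $P$ not on the unital there are exactly $q+1$ tangent lines through $P$; their points of contact with the unital are the feet of $P$, and the set of feet is $\mathrm{pedal}(P)$. A point set $\mathcal K$ is of type $(a_1,\dots,a_k)$ if every line meets $\mathcal K$ in some $a_i$ points, and of class $(a_1,\dots,a_k)$ if moreover each $a_i$ occurs as an intersection size for some line. An arc is a set of type $(0,1,2)$. A Baer subline is a set of $q+1$ points of a line of $\mathrm{PG}(2,q^2)$ projectively equivalent to $\{(a,b,0): (a,b)\in\mathbb{F}_q^2\setminus\{(0,0)\}\}$; a Baer pencil is the set of $q+1$ lines joining a point (the vertex) to the points of a Baer subline (the base). *)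

theory Defs
  imports "HOL-Analysis.Analysis"
begin

definition hc :: "'a::field \<Rightarrow> 'a \<Rightarrow> 'a \<Rightarrow> 'a^3" where
  "hc x y z = vector [x, y, z]"

definition pt :: "'a::field^3 \<Rightarrow> ('a^3) set" where
  "pt v = {c *s v | c. c \<noteq> 0}"

definition Points :: "('a::field^3) set set" where
  "Points = {pt v | v. v \<noteq> 0}"

definition bil :: "'a::field^3 \<Rightarrow> 'a^3 \<Rightarrow> 'a" where
  "bil u v = (\<Sum>i\<in>UNIV. u$i * v$i)"

definition line :: "'a::field^3 \<Rightarrow> ('a^3) set set" where
  "line u = {pt v | v. v \<noteq> 0 \<and> bil u v = 0}"

definition Lines :: "('a::field^3) set set set" where
  "Lines = {line u | u. u \<noteq> 0}"

definition l_inf :: "('a::field^3) set set" where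
  "l_inf = line (hc 0 0 1)"

definition Fq :: "nat \<Rightarrow> 'a::field set" where
  "Fq q = {x. x ^ q = x}"

definition unital_BM :: "nat \<Rightarrow> 'a::field \<Rightarrow> 'a \<Rightarrow> ('a^3) set set" where
  "unital_BM q \<alpha> \<beta> =
     {pt (hc x (\<alpha> * x^2 + \<beta> * x^(q+1) + r) 1) | x r. r \<in> Fq q} \<union> {pt (hc 0 1 0)}"

definition tangent_line :: "('a::field^3) set set \<Rightarrow> ('a^3) set set \<Rightarrow> bool" where
  "tangent_line U L \<longleftrightarrow> L \<in> Lines \<and> card (L \<inter> U) = 1"

definition pedal :: "('a::field^3) set set \<Rightarrow> ('a^3) set \<Rightarrow> ('a^3) set set" where
  "pedal U P = {Q. \<exists>L. tangent_line U L \<and> P \<in> L \<and> L \<inter> U = {Q}}"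

definition of_type :: "('a::field^3) set set \<Rightarrow> nat set \<Rightarrow> bool" where
  "of_type K A \<longleftrightarrow> (\<forall>L\<in>Lines. card (L \<inter> K) \<in> A)"

definition of_class :: "('a::field^3) set set \<Rightarrow> nat set \<Rightarrow> bool" where
  "of_class K A \<longleftrightarrow> of_type K A \<and> (\<forall>a\<in>A. \<exists>L\<in>Lines. card (L \<inter> K) = a)"

definition is_arc :: "('a::field^3) set set \<Rightarrow> bool" where
  "is_arc K \<longleftrightarrow> of_type K {0, 1, 2}"

definition baer_subline :: "nat \<Rightarrow> ('a::field^3) set set \<Rightarrow> bool" where
  "baer_subline q B \<longleftrightarrow>
     (\<exists>M :: 'a^3^3. invertible M \<and>
        B = {pt (M *v hc a b 0) | a b. a \<in> Fq q \<and> b \<in> Fq q \<and> (a, b) \<noteq> (0, 0)})"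

definition baer_pencil_ok :: "nat \<Rightarrow> ('a::field^3) set \<Rightarrow> ('a^3) set set \<Rightarrow> bool" where
  "baer_pencil_ok q V B \<longleftrightarrow> V \<in> Points \<and> baer_subline q B \<and>
     (\<forall>L\<in>Lines. B \<subseteq> L \<longrightarrow> V \<notin> L)"

definition pencil_lines :: "('a::field^3) set \<Rightarrow> ('a^3) set set \<Rightarrow> ('a^3) set set set" where
  "pencil_lines V B = {L\<in>Lines. V \<in> L \<and> L \<inter> B \<noteq> {}}"

end

theory Submission
  imports Defs
begin

text \<open>
  Write \<open>cj x\<close> for \<open>x ^ q\<close> and put the external point at \<open>(a, b, 1)\<close>. A tangent line
  touches the unital over \<open>a + x\<close> and passes through this point iff \<open>F x = - c\<close>, where
  \<open>F x = \<alpha> x^2 - cj (\<alpha> x^2) + (\<beta> - cj \<beta>) x cj x\<close> is a quadratic form on the plane over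
  the subfield of order \<open>q\<close>, anisotropic because \<open>d\<close> is a nonsquare. So the feet correspond to the
  \<open>q + 1\<close> points of an ellipse, and the second coordinate of a foot is affine in \<open>x\<close> plus the trace
  \<open>T x = \<alpha> x^2 + cj (\<alpha> x^2)\<close>. As \<open>T x\<close> lies in the subfield, the lines of slope
  \<open>2 \<alpha> a + (\<beta> - cj \<beta>) cj a\<close> through the feet belong to a Baer pencil. Any other line cuts the ellipse
  in an affine line over the subfield, hence in at most two points.

  A pencil line is given by \<open>T x = s\<close>. On it the norm \<open>n = x cj x\<close> satisfies a quadratic equation,
  \<open>d n^2 + 2 c \<delta> n + c^2 = s^2\<close>, and each admissible root \<open>n\<close> gives a pair of feet \<open>x\<close>, \<open>- x\<close>. The product of
  the two values of \<open>x^2\<close> is explicit, and comparing its norm with the product of the roots shows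
  that two distinct roots are both admissible or both not when \<open>\<alpha>\<close> is a square, and never both
  admissible otherwise. Double roots occur for at most two values of \<open>s\<close>, so there are at least
  \<open>(q - 3) / 4\<close> lines with four feet. The case \<open>q = 3\<close>, where this bound is zero, cannot
  occur for square \<open>\<alpha>\<close>.
\<close>

section \<open>Finite fields of square order\<close>

text \<open>Multiplication by a nonzero \<open>x\<close> permutes the nonzero elements, so their
  product absorbs the factor \<open>x ^ card ?U\<close>.\<close>

lemma power_card_eq_self:
  fixes x :: "'a::{finite,field}"
  shows "x ^ CARD('a) = x"
proof (cases "x = 0")
  case False
  let ?U = "UNIV - {0::'a}"
  have "bij_betw (\<lambda>y. x * y) ?U ?U"
    by (rule bij_betwI[where g = "\<lambda>y. y / x"]) (use False in auto)
  then have "(\<Prod>y\<in>?U. y) = (\<Prod>y\<in>?U. x * y)"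
    by (rule prod.reindex_bij_betw[symmetric])
  also have "\<dots> = x ^ card ?U * (\<Prod>y\<in>?U. y)"
    by (simp add: prod.distrib)
  finally have "x ^ card ?U = 1"
    by simp
  moreover have "CARD('a) = Suc (card ?U)"
    by (simp add: card_Suc_Diff1)
  ultimately show ?thesis
    by (metis mult_1_right power_Suc)
qed simp

lemma CHAR_dvd_CARD_finite: "CHAR('a::{finite,field}) dvd CARD('a)"
proof -
  have "bij (\<lambda>x::'a. x + 1)"
    by (rule bij_betwI[where g = "\<lambda>x. x - 1"]) auto
  then have "(\<Sum>x\<in>UNIV. x) = (\<Sum>x\<in>UNIV. x + 1 :: 'a)"
    by (rule sum.reindex_bij_betw[symmetric])
  also have "\<dots> = (\<Sum>x\<in>UNIV. x) + of_nat CARD('a)"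
    by (simp add: sum.distrib)
  finally show ?thesis
    by (simp add: of_nat_eq_0_iff_char_dvd)
qed

lemma card_subset_poly_roots_le:
  fixes P :: "'a::{finite,field} poly"
  assumes "degree P \<le> n" "P \<noteq> 0" "\<And>x. x \<in> S \<Longrightarrow> poly P x = 0"
  shows "card S \<le> n"
proof -
  have "card S \<le> card {x. poly P x = 0}"
    using assms(2,3) by (intro card_mono) (auto simp: poly_roots_finite)
  also have "\<dots> \<le> degree P"
    using assms(2) by (rule card_poly_roots_bound)
  finally show ?thesis
    using assms(1) by simp
qed

lemma card_quadratic_roots_le:
  fixes A B C :: "'a::{finite,field}"
  assumes "A \<noteq> 0"
  shows "card {x. A * x\<^sup>2 + B * x + C = 0} \<le> 2"
  by (rule card_subset_poly_roots_le[where P = "[:C, B, A:]"])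
     (use assms in \<open>auto simp: algebra_simps power2_eq_square\<close>)

section \<open>Conjugation and norm over the subfield of order \<open>q\<close>\<close>

locale quadratic_extension =
  fixes q :: nat and ty :: "'a::{finite,field} itself"
  assumes q_pp: "\<exists>p k. prime p \<and> k > 0 \<and> q = p ^ k"
    and q_odd: "odd q"
    and card_field: "CARD('a) = q ^ 2"
begin

definition cj :: "'a \<Rightarrow> 'a" where
  "cj z = z ^ q"

definition nm :: "'a \<Rightarrow> 'a" where
  "nm z = z * cj z"

lemma Fq_iff: "x \<in> Fq q \<longleftrightarrow> cj x = x"
  by (simp add: Fq_def cj_def)

lemma power_q1: "x ^ (q + 1) = x * cj x"
  by (simp add: cj_def)

lemma q_ge3: "q \<ge> 3"
proof -
  obtain p k where pk: "prime p" "k > 0" "q = p ^ k" using q_pp by blast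
  then have "q > 1"
    using prime_gt_1_nat one_less_power by blast
  with q_odd show ?thesis
    by presburger
qed

text \<open>Makes \<open>cj\<close> additive: its exponent \<open>q\<close> is a power of the
  characteristic.\<close>

lemma char_power: "\<exists>k. prime CHAR('a) \<and> q = CHAR('a) ^ k"
proof -
  obtain p k where pk: "prime p" "k > 0" "q = p ^ k" using q_pp by blast
  have pr: "prime CHAR('a)"
    by (rule prime_CHAR_semidom) (simp add: finite_imp_CHAR_pos)
  have "CHAR('a) dvd p ^ (k * 2)"
    using CHAR_dvd_CARD_finite[where 'a = 'a] card_field pk(3) by (simp add: power_mult)
  then have "CHAR('a) dvd p"
    using pr prime_dvd_power by blast
  then have "CHAR('a) = p"
    using pr pk(1) primes_dvd_imp_eq by blast
  with pk pr show ?thesis by auto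
qed

lemma two_nz: "(2::'a) \<noteq> 0"
proof
  assume "(2::'a) = 0"
  then have "of_nat 2 = (0::'a)" by simp
  then have "CHAR('a) dvd 2"
    using of_nat_eq_0_iff_char_dvd by blast
  with char_power have "CHAR('a) = 2"
    using primes_dvd_imp_eq two_is_prime_nat by blast
  moreover have "q \<noteq> 1" using q_ge3 by simp
  ultimately show False
    using char_power q_odd by (metis even_power gr0I power_0 even_numeral)
qed

lemma four_nz: "(4::'a) \<noteq> 0"
proof -
  have "(4::'a) = 2 * 2" by simp
  then show ?thesis
    using two_nz by (metis mult_eq_0_iff)
qed

lemma cj_add [simp]: "cj (x + y) = cj x + cj y"
  using char_power unfolding cj_def by (metis freshmans_dream')

lemma cj_mult [simp]: "cj (x * y) = cj x * cj y"
  by (simp add: cj_def power_mult_distrib)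

lemma cj_0 [simp]: "cj 0 = 0" and cj_1 [simp]: "cj 1 = 1"
  using q_ge3 by (auto simp: cj_def)

lemma cj_minus [simp]: "cj (- x) = - cj x"
  using q_odd by (simp add: cj_def)

lemma cj_diff [simp]: "cj (x - y) = cj x - cj y"
  using cj_add[of x "- y"] by simp

lemma cj_power [simp]: "cj (x ^ n) = cj x ^ n"
  by (simp add: cj_def mult.commute flip: power_mult)

lemma cj_2 [simp]: "cj 2 = 2"
  using cj_add[of 1 1] by simp

lemma cj_4 [simp]: "cj 4 = 4"
  using cj_mult[of 2 2] by simp

lemma cj_divide [simp]: "cj (x / y) = cj x / cj y"
  by (simp add: cj_def power_divide)

lemma cj_cj [simp]: "cj (cj x) = x"
  using power_card_eq_self[of x] card_field
  by (simp add: cj_def power2_eq_square flip: power_mult)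

lemma cj_eq_0_iff [simp]: "cj x = 0 \<longleftrightarrow> x = 0"
  using q_ge3 by (auto simp: cj_def)

lemma nm_eq_0_iff [simp]: "nm x = 0 \<longleftrightarrow> x = 0"
  by (simp add: nm_def)

lemma cj_nm [simp]: "cj (nm x) = nm x"
  by (simp add: nm_def)

lemma card_fixed_le: "card {x. cj x = x} \<le> q"
proof (rule card_subset_poly_roots_le)
  let ?P = "monom 1 q - monom 1 1 :: 'a poly"
  show "degree ?P \<le> q"
    by (rule order.trans[OF degree_diff_le_max]) (use q_ge3 in \<open>auto simp: degree_monom_eq\<close>)
  have "coeff ?P q = 1" using q_ge3 by simp
  then show "?P \<noteq> 0" by (metis coeff_0 zero_neq_one)
  show "poly ?P x = 0" if "x \<in> {x. cj x = x}" for x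
    using that by (simp add: poly_monom cj_def)
qed

lemma card_nm_fiber_le: "card {z. nm z = k} \<le> q + 1"
proof (rule card_subset_poly_roots_le)
  let ?P = "monom 1 (q + 1) - [:k:] :: 'a poly"
  show "degree ?P \<le> q + 1"
    by (rule order.trans[OF degree_diff_le_max]) (auto simp: degree_monom_eq)
  have "coeff ?P (q + 1) = 1" by (simp add: coeff_pCons)
  then show "?P \<noteq> 0" by (metis coeff_0 zero_neq_one)
  show "poly ?P x = 0" if "x \<in> {z. nm z = k}" for x
    using that by (simp add: poly_monom cj_def nm_def)
qed

text \<open>Pigeonhole: the \<open>q ^ 2 - 1\<close> nonzero elements are spread over at most
  \<open>q - 1\<close> fibres of size at most \<open>q + 1\<close>, so no fibre can be
  short.\<close>

lemma card_nm_fiber: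
  assumes "cj k = k" "k \<noteq> 0"
  shows "card {z. nm z = k} = q + 1"
proof (rule ccontr)
  assume "card {z. nm z = k} \<noteq> q + 1"
  then have lt: "card {z. nm z = k} < q + 1"
    using card_nm_fiber_le[of k] by simp
  define K where "K = {x. cj x = x} - {0::'a}"
  have "card {x. cj x = x} = Suc (card K)"
    unfolding K_def by (subst card_Suc_Diff1) auto
  then have K: "card K \<le> q - 1"
    using card_fixed_le by simp
  have "q ^ 2 - 1 = card (UNIV - {0::'a})"
    by (simp add: card_field card_Diff_subset)
  also have "UNIV - {0::'a} = (\<Union>j\<in>K. {z. nm z = j})"
    by (auto simp: K_def)
  also have "card \<dots> = (\<Sum>j\<in>K. card {z. nm z = j})"
    by (rule card_UN_disjoint) auto
  also have "\<dots> < (\<Sum>j\<in>K. q + 1)"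
    by (rule sum_strict_mono_ex1) (use lt card_nm_fiber_le assms in \<open>auto simp: K_def intro!: bexI[of _ k]\<close>)
  also have "\<dots> \<le> (q - 1) * (q + 1)"
    using K by (simp only: sum_constant of_nat_id mult_le_mono1)
  also have "\<dots> = q ^ 2 - 1"
    by (simp add: algebra_simps power2_eq_square)
  finally show False by simp
qed

text \<open>A nonzero subfield element is a norm \<open>z ^ (q + 1)\<close>, and the exponent is
  even.\<close>

lemma fixed_is_square:
  assumes "cj k = k"
  shows "\<exists>y. y\<^sup>2 = k"
proof (cases "k = 0")
  case False
  then have "card {z. nm z = k} \<noteq> 0"
    using card_nm_fiber assms by simp
  then obtain z where z: "nm z = k"
    by (metis (mono_tags, lifting) Collect_empty_eq card.empty)
  obtain j where "q + 1 = 2 * j"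
    using q_odd by (metis evenE even_plus_one_iff)
  then have "(z ^ j)\<^sup>2 = k"
    using z by (metis mult.commute nm_def power_mult power_q1)
  then show ?thesis ..
qed (auto intro: exI[of _ 0])

lemma ex_nonfixed: "\<exists>t. cj t \<noteq> t"
proof (rule ccontr)
  assume "\<nexists>t. cj t \<noteq> t"
  then have "{x. cj x = x} = UNIV" by auto
  then have "q ^ 2 \<le> q * 1"
    using card_fixed_le card_field by simp
  with q_ge3 show False
    by (simp add: power2_eq_square)
qed

text \<open>The witness \<open>1 + cj r\<close> works unless it vanishes, which happens only for
  \<open>r = -1\<close>; there any \<open>t - cj t\<close> with \<open>t\<close> outside the
  subfield serves.\<close>

lemma hilbert90:
  assumes "nm r = 1"
  shows "\<exists>y. y \<noteq> 0 \<and> cj y = r * y"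
proof (cases "r = -1")
  case True
  obtain t where "cj t \<noteq> t" using ex_nonfixed by blast
  then show ?thesis
    using True by (intro exI[of _ "t - cj t"]) simp
next
  case False
  have "1 + cj r \<noteq> 0"
  proof
    assume "1 + cj r = 0"
    then have "cj r = - 1" by (simp add: add_eq_0_iff)
    then have "cj (cj r) = - 1" by simp
    with False show False by simp
  qed
  then show ?thesis
    using assms by (intro exI[of _ "1 + cj r"]) (auto simp: nm_def algebra_simps)
qed

end

section \<open>The conic of feet\<close>

locale buekenhout_metz = quadratic_extension q "TYPE('a::{finite,field})" for q +
  fixes \<alpha> \<beta> :: "'a::{finite,field}"
  assumes \<alpha>_nz: "\<alpha> \<noteq> 0"
    and d_nonsq: "\<not> (\<exists>y\<in>Fq q. y ^ 2 = (\<beta> ^ q - \<beta>) ^ 2 + 4 * \<alpha> ^ (q + 1))"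
begin

definition \<delta> :: 'a where "\<delta> = \<beta> - cj \<beta>"

definition d :: 'a where "d = \<delta>\<^sup>2 + 4 * nm \<alpha>"

definition F :: "'a \<Rightarrow> 'a" where
  "F x = \<alpha> * x\<^sup>2 - cj \<alpha> * (cj x)\<^sup>2 + \<delta> * nm x"

definition T :: "'a \<Rightarrow> 'a" where
  "T x = \<alpha> * x\<^sup>2 + cj \<alpha> * (cj x)\<^sup>2"

lemma cj_\<delta> [simp]: "cj \<delta> = - \<delta>"
  by (simp add: \<delta>_def)

lemma cj_d [simp]: "cj d = d"
  by (simp add: d_def)

lemma cj_T [simp]: "cj (T x) = T x"
  by (simp add: T_def)

lemma sq_neq_d:
  assumes "cj y = y"
  shows "y\<^sup>2 \<noteq> d"
proof
  assume "y\<^sup>2 = d"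
  then have "y ^ 2 = (\<beta> ^ q - \<beta>) ^ 2 + 4 * \<alpha> ^ (q + 1)"
    unfolding d_def \<delta>_def nm_def power_q1 by (simp add: power2_commute flip: cj_def)
  with assms d_nonsq show False
    by (auto simp: Fq_iff)
qed

lemma d_nz: "d \<noteq> 0"
  using sq_neq_d[of 0] by auto

text \<open>As a subfield element \<open>d\<close> has a root in the large field; the root is not
  fixed because \<open>d\<close> is a nonsquare in the subfield, so conjugation negates it.\<close>

lemma sqrt_d: obtains e where "e\<^sup>2 = d" "cj e = - e" "e \<noteq> 0"
proof -
  obtain e where e: "e\<^sup>2 = d"
    using fixed_is_square[of d] by auto
  have "(cj e)\<^sup>2 = e\<^sup>2"
    using e by (metis cj_d cj_power)
  then have "cj e = - e"
    using e sq_neq_d by (metis power2_eq_iff)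
  with e d_nz show thesis
    by (intro that[of e]) auto
qed

text \<open>\<open>T x\<close> and \<open>F x - \<delta> * nm x\<close> are the sum and the
  difference of \<open>\<alpha> * x\<^sup>2\<close> and its conjugate, whose product is
  \<open>nm \<alpha> * (nm x)\<^sup>2\<close>.\<close>

lemma T_sq: "(T x)\<^sup>2 = d * (nm x)\<^sup>2 - 2 * F x * \<delta> * nm x + (F x)\<^sup>2"
  unfolding T_def F_def d_def nm_def by algebra

text \<open>Anisotropy: at a nonzero zero of \<open>F\<close>, the quotient
  \<open>T x / nm x\<close> would be a root of \<open>d\<close> in the subfield.\<close>

lemma F_eq_0_iff [simp]: "F x = 0 \<longleftrightarrow> x = 0"
proof
  assume "F x = 0"
  then have *: "(T x)\<^sup>2 = d * (nm x)\<^sup>2"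
    using T_sq[of x] by simp
  show "x = 0"
  proof (rule ccontr)
    assume "x \<noteq> 0"
    then have "(T x / nm x)\<^sup>2 = d"
      using * by (simp add: power_divide)
    moreover have "cj (T x / nm x) = T x / nm x" by simp
    ultimately show False
      using sq_neq_d by blast
  qed
qed (simp add: F_def)

lemma nm_minus [simp]: "nm (- x) = nm x"
  by (simp add: nm_def)

lemma nm_0 [simp]: "nm 0 = 0"
  by simp

lemma F_0 [simp]: "F 0 = 0"
  by simp

lemma F_minus [simp]: "F (- x) = F x" and T_minus [simp]: "T (- x) = T x"
  by (auto simp: F_def T_def)

lemma ex_norm_form: "\<exists>\<kappa> s. \<kappa> \<noteq> 0 \<and> cj \<kappa> = - \<kappa> \<and> (\<forall>x. F x = \<kappa> * nm (x + s * cj x))"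
proof -
  obtain e where e: "e\<^sup>2 = d" "cj e = - e" "e \<noteq> 0" by (rule sqrt_d)
  \<comment> \<open>Comparing coefficients of the two forms gives \<open>\<kappa> s = - cj \<alpha>\<close> and \<open>\<kappa>^2 - \<delta> \<kappa> = nm \<alpha>\<close>.\<close>
  define \<kappa> where "\<kappa> = (\<delta> + e) / 2"
  have \<kappa>2: "2 * \<kappa> = \<delta> + e"
    using two_nz by (simp add: \<kappa>_def)
  have "4 * (\<kappa>\<^sup>2 - \<delta> * \<kappa>) = (2 * \<kappa> - \<delta>)\<^sup>2 - \<delta>\<^sup>2"
    by algebra
  also have "\<dots> = 4 * nm \<alpha>"
    unfolding \<kappa>2 using e(1) by (simp add: d_def)
  finally have \<kappa>: "\<kappa>\<^sup>2 - \<delta> * \<kappa> = nm \<alpha>"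
    using four_nz by (metis mult_left_cancel)
  have nz: "\<kappa> \<noteq> 0"
    using \<kappa> \<alpha>_nz by (intro notI) simp
  have cj\<kappa>: "cj \<kappa> = - \<kappa>"
    using e(2) by (simp add: \<kappa>_def minus_divide_left)
  define s where "s = - cj \<alpha> / \<kappa>"
  have s: "\<kappa> * s = - cj \<alpha>"
    using nz by (simp add: s_def)
  have cs: "\<kappa> * cj s = \<alpha>"
    using nz cj\<kappa> by (simp add: s_def)
  have "\<kappa> * (\<kappa> * (1 + s * cj s) - \<delta>) = 0"
    using \<kappa> s cs unfolding nm_def by algebra
  then have ks: "\<kappa> * (1 + s * cj s) = \<delta>"
    using nz by simp
  have "F x = \<kappa> * nm (x + s * cj x)" for x
    using s cs ks unfolding F_def nm_def cj_add cj_mult cj_cj by algebra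
  with nz cj\<kappa> show ?thesis by blast
qed

text \<open>By \<open>ex_norm_form\<close>, \<open>F\<close> is a multiple of the norm after an
  additive substitution. That substitution is injective because \<open>F\<close> is anisotropic, so
  it maps the conic bijectively onto a norm fibre.\<close>

lemma card_conic:
  assumes "cj c = - c" "c \<noteq> 0"
  shows "card {x. F x = - c} = q + 1"
proof -
  obtain \<kappa> s where \<kappa>: "\<kappa> \<noteq> 0" "cj \<kappa> = - \<kappa>" and F: "\<And>x. F x = \<kappa> * nm (x + s * cj x)"
    using ex_norm_form by blast
  let ?L = "\<lambda>x. x + s * cj x"
  have "inj ?L"
  proof (rule injI)
    fix x y assume "?L x = ?L y"
    then have "?L (x - y) = 0" by (simp add: algebra_simps)
    then have "F (x - y) = 0" by (simp add: F nm_def)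
    then show "x = y" by simp
  qed
  then have bij: "bij ?L"
    by (simp add: bij_def finite_UNIV_inj_surj)
  have "?L ` {x. F x = - c} = {z. nm z = - c / \<kappa>}"
  proof (intro equalityI subsetI)
    fix z assume "z \<in> {z. nm z = - c / \<kappa>}"
    moreover obtain x where "z = ?L x"
      using bij_is_surj[OF bij] by (rule surjE)
    ultimately show "z \<in> ?L ` {x. F x = - c}"
      using \<kappa>(1) by (auto simp: F)
  qed (use \<kappa>(1) in \<open>auto simp: F eq_divide_eq mult.commute simp del: divide_minus_left\<close>)
  then have "card {x. F x = - c} = card {z. nm z = - c / \<kappa>}"
    using card_image[OF inj_on_subset[OF \<open>inj ?L\<close> subset_UNIV], of "{x. F x = - c}"] by simp
  then show ?thesis
    using card_nm_fiber[of "- c / \<kappa>"] assms \<kappa> by simp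
qed

text \<open>The subfield element \<open>t = \<mu> * x + k\<close> parametrises the affine line. In
  \<open>t\<close> the conic becomes a quadratic equation whose leading coefficient
  \<open>F i\<close> is nonzero by anisotropy.\<close>

lemma card_conic_affine_line_le:
  assumes "\<mu> \<noteq> 0"
  shows "card {x. F x = - c \<and> cj (\<mu> * x + k) = \<mu> * x + k} \<le> 2"
proof -
  define i where "i = 1 / \<mu>"
  let ?G = "\<lambda>x. \<mu> * x + k"
  let ?S = "{x. F x = - c \<and> cj (\<mu> * x + k) = \<mu> * x + k}"
  \<comment> \<open>The linear coefficient of \<open>F ((t - k) * i)\<close> in \<open>t\<close>,
    for \<open>t\<close> in the subfield.\<close>
  define B where "B = 2 * cj \<alpha> * cj k * (cj i)\<^sup>2 - 2 * \<alpha> * k * i\<^sup>2 - \<delta> * (k + cj k) * nm i"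
  have i: "i \<noteq> 0"
    using assms by (simp add: i_def)
  have "inj ?G"
    using assms by (auto simp: inj_def)
  then have "card ?S = card (?G ` ?S)"
    using card_image[OF inj_on_subset[OF _ subset_UNIV], of ?G ?S] by simp
  also have "\<dots> \<le> card {t. F i * t\<^sup>2 + B * t + (F (k * i) + c) = 0}"
  proof (rule card_mono)
    show "?G ` ?S \<subseteq> {t. F i * t\<^sup>2 + B * t + (F (k * i) + c) = 0}"
    proof safe
      fix x assume x: "F x = - c" and "cj (\<mu> * x + k) = \<mu> * x + k"
      define t where "t = \<mu> * x + k"
      have t: "cj t = t" unfolding t_def by fact
      have "x = (t - k) * i"
        using assms by (simp add: t_def i_def)
      then have "F ((t - k) * i) = - c"
        using x by simp
      then have "F i * t\<^sup>2 + B * t + (F (k * i) + c) = 0"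
        unfolding F_def nm_def B_def cj_mult cj_diff t by algebra
      then show "F i * (\<mu> * x + k)\<^sup>2 + B * (\<mu> * x + k) + (F (k * i) + c) = 0"
        by (simp only: t_def)
    qed
  qed simp
  also have "\<dots> \<le> 2"
    by (rule card_quadratic_roots_le) (use i in simp)
  finally show ?thesis .
qed

section \<open>Slices of the conic by the trace \<open>T\<close>\<close>

lemma pencil_eqs:
  assumes "F x = - c" "T x = s"
  shows "2 * (\<alpha> * x\<^sup>2) = s - c - \<delta> * nm x"
    and "d * (nm x)\<^sup>2 + 2 * c * \<delta> * nm x + c\<^sup>2 = s\<^sup>2"
proof -
  show "2 * (\<alpha> * x\<^sup>2) = s - c - \<delta> * nm x"
    using assms unfolding F_def T_def by algebra
  show "d * (nm x)\<^sup>2 + 2 * c * \<delta> * nm x + c\<^sup>2 = s\<^sup>2"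
    using T_sq[of x] assms by algebra
qed

lemma same_norm_pencil_eq:
  assumes "F x = - c" "T x = s" "F y = - c" "T y = s" "nm x = nm y"
  shows "y = x \<or> y = - x"
proof -
  have "2 * (\<alpha> * x\<^sup>2) = 2 * (\<alpha> * y\<^sup>2)"
    using pencil_eqs(1)[OF assms(1,2)] pencil_eqs(1)[OF assms(3,4)] assms(5) by simp
  then have "y\<^sup>2 = x\<^sup>2"
    using two_nz \<alpha>_nz by simp
  then show ?thesis
    by (simp add: power2_eq_iff)
qed

text \<open>The offsets \<open>x\<close> whose feet lie on one line of the pencil, the later
  \<open>pencil_line s\<close>.\<close>

definition slice :: "'a \<Rightarrow> 'a \<Rightarrow> 'a set" where
  "slice c s = {x. F x = - c \<and> T x = s}"

lemma same_norm_pair: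
  assumes "x \<in> slice c s" "c \<noteq> 0"
  shows "{y \<in> slice c s. nm y = nm x} = {x, - x}" "card {x, - x} = 2"
proof -
  have x: "F x = - c" "T x = s" using assms(1) by (auto simp: slice_def)
  have "y = x \<or> y = - x" if "y \<in> slice c s" "nm y = nm x" for y
    using same_norm_pencil_eq[OF x] that by (simp add: slice_def)
  moreover have "{x, - x} \<subseteq> slice c s"
    using x by (simp add: slice_def)
  ultimately show "{y \<in> slice c s. nm y = nm x} = {x, - x}"
    by auto
  have "x \<noteq> 0"
    using x assms(2) by auto
  then have "x \<noteq> - x"
    using two_nz by (metis add_eq_0_iff mult_2 mult_eq_0_iff)
  then show "card {x, - x} = 2" by simp
qed

text \<open>Vieta's formulas: two distinct norms in a slice are the two roots of the quadratic in
  \<open>pencil_eqs\<close>.\<close>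

lemma nm_vieta:
  assumes "x \<in> slice c s" "y \<in> slice c s" "nm x \<noteq> nm y"
  shows "d * (nm x + nm y) = - 2 * c * \<delta>" "d * (nm x * nm y) = c\<^sup>2 - s\<^sup>2"
proof -
  note x = pencil_eqs(2)[of x c s] and y = pencil_eqs(2)[of y c s]
  have x: "d * (nm x)\<^sup>2 + 2 * c * \<delta> * nm x + c\<^sup>2 = s\<^sup>2"
    and y: "d * (nm y)\<^sup>2 + 2 * c * \<delta> * nm y + c\<^sup>2 = s\<^sup>2"
    using assms x y by (auto simp: slice_def)
  have "(nm x - nm y) * (d * (nm x + nm y) + 2 * c * \<delta>) = 0"
    using x y by algebra
  then show *: "d * (nm x + nm y) = - 2 * c * \<delta>"
    using assms(3) by (simp add: add_eq_0_iff)
  show "d * (nm x * nm y) = c\<^sup>2 - s\<^sup>2"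
    using x * by algebra
qed

lemma diff_nz:
  assumes "cj c = - c" "c \<noteq> 0" "cj s = s"
  shows "s - c \<noteq> 0" "s + c \<noteq> 0"
proof -
  have c: "c \<noteq> - c"
    using assms(2) two_nz by (metis add_eq_0_iff mult_2 mult_eq_0_iff)
  then show "s - c \<noteq> 0"
    using assms(1,3) by auto
  show "s + c \<noteq> 0"
  proof
    assume "s + c = 0"
    then have "s = - c" by (simp add: eq_neg_iff_add_eq_0)
    with assms(1,3) c show False by simp
  qed
qed

text \<open>The factors are the values that \<open>pencil_eqs\<close> assigns to twice
  \<open>\<alpha> * x\<^sup>2\<close> at the norms \<open>m\<close> and \<open>n\<close>. Formal
  roots are used because \<open>partner\<close> needs the identity before the second root is known
  to be a norm of a slice point.\<close>

lemma conic_square_product: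
  assumes n: "d * (m + n) = - 2 * c * \<delta>" "d * (m * n) = c\<^sup>2 - s\<^sup>2"
  shows "d * ((s - c - \<delta> * m) * (s - c - \<delta> * n)) = 4 * nm \<alpha> * (s - c)\<^sup>2"
proof -
  have "d * ((s - c - \<delta> * m) * (s - c - \<delta> * n)) =
      d * (s - c)\<^sup>2 - \<delta> * (s - c) * (d * (m + n)) + \<delta>\<^sup>2 * (d * (m * n))"
    by algebra
  also have "\<dots> = 4 * nm \<alpha> * (s - c)\<^sup>2"
    unfolding n unfolding d_def by algebra
  finally show ?thesis .
qed

text \<open>The explicit product of squares yields \<open>r\<close> of norm one with
  \<open>\<alpha> * r\<^sup>2 = cj \<alpha>\<close>. Hilbert 90 writes \<open>r\<close> as
  \<open>cj y / y\<close>, so \<open>\<alpha> / y\<^sup>2\<close> is in the subfield and hence a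
  square.\<close>

lemma square_if_two_norms:
  assumes c: "cj c = - c" "c \<noteq> 0"
    and xy: "x \<in> slice c s" "y \<in> slice c s" "nm x \<noteq> nm y"
  shows "\<exists>z. z\<^sup>2 = \<alpha>"
proof -
  obtain e where e: "e\<^sup>2 = d" "cj e = - e" "e \<noteq> 0" by (rule sqrt_d)
  have s: "cj s = s" using xy(1) by (auto simp: slice_def)
  note nz = diff_nz[OF c s]
  have X: "2 * (\<alpha> * x\<^sup>2) = s - c - \<delta> * nm x" and Y: "2 * (\<alpha> * y\<^sup>2) = s - c - \<delta> * nm y"
    using pencil_eqs(1) xy by (auto simp: slice_def)
  note v = nm_vieta[OF xy]
  define r where "r = e * x * y / (s - c)"
  have r: "r * (s - c) = e * x * y"
    using nz by (simp add: r_def)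
  have "4 * nm \<alpha> * (s - c)\<^sup>2 = d * ((2 * (\<alpha> * x\<^sup>2)) * (2 * (\<alpha> * y\<^sup>2)))"
    unfolding X Y using conic_square_product[OF v] by simp
  also have "\<dots> = 4 * (\<alpha> * (r * (s - c))\<^sup>2 * \<alpha>)"
    unfolding r e(1)[symmetric] by algebra
  finally have "(4 * \<alpha> * (s - c)\<^sup>2) * (cj \<alpha> - \<alpha> * r\<^sup>2) = 0"
    unfolding nm_def by algebra
  then have r2: "\<alpha> * r\<^sup>2 = cj \<alpha>"
    using nz \<alpha>_nz four_nz by simp
  \<comment> \<open>The conjugate of \<open>s - c\<close> is \<open>s + c\<close>. The sign coming
    from \<open>cj e = - e\<close> cancels the one in the product of the two norms.\<close>
  have "nm r * ((s - c) * (s + c)) = (r * (s - c)) * cj (r * (s - c))"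
    by (simp add: nm_def s c algebra_simps)
  also have "\<dots> = - (d * (nm x * nm y))"
    unfolding r unfolding nm_def cj_mult e(2) e(1)[symmetric] by algebra
  also have "\<dots> = (s - c) * (s + c)"
    unfolding v(2) by algebra
  finally have "nm r = 1"
    using nz by simp
  then obtain y where y: "y \<noteq> 0" "cj y = r * y"
    using hilbert90 by blast
  have "r \<noteq> 0"
    using \<open>nm r = 1\<close> by auto
  then have "cj (\<alpha> / y\<^sup>2) = \<alpha> / y\<^sup>2"
    by (simp add: y(2) power_mult_distrib flip: r2)
  then obtain k where "k\<^sup>2 = \<alpha> / y\<^sup>2"
    using fixed_is_square by blast
  then have "(k * y)\<^sup>2 = \<alpha>"
    using y(1) by (simp add: power_mult_distrib)
  then show ?thesis ..
qed

lemma card_slice_le_2: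
  assumes c: "cj c = - c" "c \<noteq> 0"
    and eq: "\<And>x y. x \<in> slice c s \<Longrightarrow> y \<in> slice c s \<Longrightarrow> nm x = nm y"
  shows "card (slice c s) = 0 \<or> card (slice c s) = 2"
proof (cases "slice c s = {}")
  case False
  then obtain x where x: "x \<in> slice c s" by blast
  then have "{y \<in> slice c s. nm y = nm x} = slice c s"
    using eq by blast
  then show ?thesis
    using same_norm_pair[OF x c(2)] by simp
qed simp

lemma card_slice_nonsquare:
  assumes "cj c = - c" "c \<noteq> 0" "\<nexists>z. z\<^sup>2 = \<alpha>"
  shows "card (slice c s) = 0 \<or> card (slice c s) = 2"
  using card_slice_le_2[OF assms(1,2)] square_if_two_norms[OF assms(1,2)] assms(3) by blast

text \<open>Converse of \<open>square_if_two_norms\<close>: for square \<open>\<alpha>\<close> the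
  second root of the norm equation is attained as well, possibly coinciding with the first.\<close>

lemma partner:
  assumes c: "cj c = - c" "c \<noteq> 0" and \<alpha>: "z\<^sup>2 = \<alpha>" and x: "x \<in> slice c s"
  shows "\<exists>y \<in> slice c s. nm y = - 2 * c * \<delta> / d - nm x"
proof -
  obtain e where e: "e\<^sup>2 = d" "cj e = - e" "e \<noteq> 0" by (rule sqrt_d)
  have s: "cj s = s" using x by (auto simp: slice_def)
  note nz = diff_nz[OF c s]
  have x': "F x = - c" "T x = s" using x by (auto simp: slice_def)
  have xnz: "x \<noteq> 0" using x' c(2) by auto
  define n where "n = - 2 * c * \<delta> / d - nm x"
  have n1: "d * (nm x + n) = - 2 * c * \<delta>"
    using d_nz by (simp add: n_def)
  have n2: "d * (nm x * n) = c\<^sup>2 - s\<^sup>2"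
    using n1 pencil_eqs(2)[OF x'] by algebra
  have znz: "z \<noteq> 0" using \<alpha> \<alpha>_nz by auto
  \<comment> \<open>Solves \<open>e * x * y = (s - c) * r\<close> for \<open>r = cj z / z\<close>,
    which has norm one and satisfies \<open>\<alpha> * r\<^sup>2 = cj \<alpha>\<close>.\<close>
  define y where "y = (s - c) * cj z / (z * e * x)"
  have y: "e * x * z * y = (s - c) * cj z"
    using znz e xnz by (simp add: y_def)
  have nmz: "nm z \<noteq> 0" and nmx: "nm x \<noteq> 0" using znz xnz by auto
  have "(d * nm x * nm z) * (nm y - n) = 0"
  proof -
    have "(e * x * z * y) * cj (e * x * z * y) = ((s - c) * cj z) * ((s + c) * z)"
      unfolding y by (simp add: s c)
    then have "- (d * nm x * nm z * nm y) = (s\<^sup>2 - c\<^sup>2) * nm z"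
      unfolding nm_def cj_mult e(2) e(1)[symmetric] by algebra
    then show ?thesis
      using n2 by algebra
  qed
  then have n: "nm y = n"
    using d_nz nmx nmz by simp
  \<comment> \<open>With the norm of \<open>y\<close> settled, cancelling the factor of
    \<open>x\<close> recovers the first equation of \<open>pencil_eqs\<close> for \<open>y\<close>;
    together with its conjugate it determines \<open>F y\<close> and \<open>T y\<close>.\<close>
  have "(2 * (\<alpha> * x\<^sup>2) * d) * (2 * (\<alpha> * y\<^sup>2)) = 4 * \<alpha> * (e * x * z * y)\<^sup>2"
    unfolding power_mult_distrib e(1) \<alpha> by algebra
  also have "\<dots> = 4 * nm \<alpha> * (s - c)\<^sup>2"
    unfolding y nm_def \<alpha>[symmetric] cj_power by algebra
  also have "\<dots> = d * ((s - c - \<delta> * nm x) * (s - c - \<delta> * n))"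
    by (rule conic_square_product[OF n1 n2, symmetric])
  also have "\<dots> = (2 * (\<alpha> * x\<^sup>2) * d) * (s - c - \<delta> * n)"
    unfolding pencil_eqs(1)[OF x'] by simp
  finally have "(2 * (\<alpha> * x\<^sup>2) * d) * (2 * (\<alpha> * y\<^sup>2)) = (2 * (\<alpha> * x\<^sup>2) * d) * (s - c - \<delta> * n)" .
  moreover have "2 * (\<alpha> * x\<^sup>2) * d \<noteq> 0"
    using d_nz two_nz \<alpha>_nz xnz by simp
  ultimately have w: "2 * (\<alpha> * y\<^sup>2) = s - c - \<delta> * n"
    by (metis mult_left_cancel)
  have "cj (2 * (\<alpha> * y\<^sup>2)) = s + c + \<delta> * n"
    unfolding w n[symmetric] by (simp add: s c)
  then have w': "2 * (cj \<alpha> * (cj y)\<^sup>2) = s + c + \<delta> * n"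
    by simp
  have "2 * T y = 2 * s" "2 * F y = 2 * (- c)"
    unfolding T_def F_def n using w w' by algebra+
  then have "T y = s" "F y = - c"
    using two_nz by (metis mult_left_cancel)+
  then have "y \<in> slice c s"
    by (simp add: slice_def)
  with n show ?thesis
    by (auto simp: n_def)
qed

text \<open>Each norm contributes a pair \<open>x\<close>, \<open>- x\<close>. A nonempty slice has
  two norms unless the root is double; the extra equation in that case is the vanishing
  discriminant, kept because it leaves at most two values of \<open>s\<close>.\<close>

lemma card_slice_square:
  assumes c: "cj c = - c" "c \<noteq> 0" and \<alpha>: "z\<^sup>2 = \<alpha>"
  shows "card (slice c s) = 0 \<or> card (slice c s) = 4 \<or>
    card (slice c s) = 2 \<and> d * s\<^sup>2 = (2 * c)\<^sup>2 * nm \<alpha>"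
proof (cases "slice c s = {}")
  case False
  then obtain x where x: "x \<in> slice c s" by blast
  obtain y where y: "y \<in> slice c s" "nm y = - 2 * c * \<delta> / d - nm x"
    using partner[OF c \<alpha> x] by blast
  have sum: "d * (nm x + nm y) = - 2 * c * \<delta>"
    using y(2) d_nz by simp
  have other: "nm u = nm x \<or> nm u = nm y" if "u \<in> slice c s" for u
  proof (cases "nm u = nm x")
    case False
    then have "d * (nm x + nm u) = d * (nm x + nm y)"
      using nm_vieta(1)[OF x that] sum by metis
    then show ?thesis using d_nz by simp
  qed simp
  show ?thesis
  proof (cases "nm x = nm y")
    case True
    have "card (slice c s) = 2"
      using card_slice_le_2[OF c] other True x by (metis False card_0_eq finite)
    moreover have "d * (d * s\<^sup>2 - (2 * c)\<^sup>2 * nm \<alpha>) = 0"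
    proof -
      have "F x = - c" "T x = s" using x by (auto simp: slice_def)
      note * = pencil_eqs(2)[OF this]
      have "2 * (d * nm x + c * \<delta>) = 0"
        using sum True by algebra
      then have "d * nm x + c * \<delta> = 0"
        using two_nz by (metis mult_eq_0_iff)
      then show ?thesis
        using * unfolding d_def by algebra
    qed
    ultimately show ?thesis
      using d_nz by simp
  next
    case False
    have "slice c s = {x, - x} \<union> {y, - y}"
      using other same_norm_pair(1)[OF x c(2)] same_norm_pair(1)[OF y(1) c(2)] by blast
    moreover have "{x, - x} \<inter> {y, - y} = {}"
      using False by (auto simp: nm_def)
    ultimately have "card (slice c s) = card {x, - x} + card {y, - y}"
      using card_Un_disjoint[of "{x, - x}" "{y, - y}"] by simp
    then have "card (slice c s) = 4"
      using same_norm_pair(2)[OF x c(2)] same_norm_pair(2)[OF y(1) c(2)] by simp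
    then show ?thesis by simp
  qed
qed simp

text \<open>The \<open>q + 1\<close> conic points are split into slices of size four and at most two
  of size two. The additive form avoids truncated subtraction.\<close>

lemma count_four_secants:
  assumes c: "cj c = - c" "c \<noteq> 0" and \<alpha>: "z\<^sup>2 = \<alpha>"
  shows "q + 1 \<le> 4 * card {s. card (slice c s) = 4} + 4"
proof -
  define S4 where "S4 = {s. card (slice c s) = 4}"
  define S2 where "S2 = {s. card (slice c s) = 2}"
  have "S2 \<subseteq> {s. d * s\<^sup>2 + 0 * s + (- ((2 * c)\<^sup>2 * nm \<alpha>)) = 0}"
  proof
    fix s assume "s \<in> S2"
    then show "s \<in> {s. d * s\<^sup>2 + 0 * s + (- ((2 * c)\<^sup>2 * nm \<alpha>)) = 0}"
      using card_slice_square[OF c \<alpha>, of s] by (simp add: S2_def)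
  qed
  then have "card S2 \<le> card {s. d * s\<^sup>2 + 0 * s + (- ((2 * c)\<^sup>2 * nm \<alpha>)) = 0}"
    by (intro card_mono) auto
  also have "\<dots> \<le> 2"
    using card_quadratic_roots_le d_nz by blast
  finally have S2: "card S2 \<le> 2" .
  have "q + 1 = card {x. F x = - c}"
    using card_conic[OF c] by simp
  also have "{x. F x = - c} = (\<Union>s\<in>UNIV. slice c s)"
    by (auto simp: slice_def)
  also have "card \<dots> = (\<Sum>s\<in>UNIV. card (slice c s))"
    by (rule card_UN_disjoint) (auto simp: slice_def)
  also have "\<dots> = (\<Sum>s\<in>S4 \<union> S2. card (slice c s))"
    by (rule sum.mono_neutral_right) (use card_slice_square[OF c \<alpha>] in \<open>auto simp: S4_def S2_def\<close>)
  also have "\<dots> = (\<Sum>s\<in>S4. card (slice c s)) + (\<Sum>s\<in>S2. card (slice c s))"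
    by (rule sum.union_disjoint) (auto simp: S4_def S2_def)
  also have "\<dots> = 4 * card S4 + 2 * card S2"
    by (simp add: S4_def S2_def)
  finally show ?thesis
    using S2 by (simp add: S4_def)
qed

text \<open>For \<open>q = 3\<close> nonzero subfield elements square to one, so a square
  \<open>\<alpha>\<close> has norm one and \<open>d = \<delta>\<^sup>2 + 1\<close>. Being a
  nonsquare, \<open>d\<close> is \<open>- 1\<close>, whence \<open>\<delta>\<close> is
  \<open>1\<close> or \<open>- 1\<close>; but conjugation negates \<open>\<delta>\<close>.\<close>

lemma square_imp_q_neq_3:
  assumes \<alpha>: "z\<^sup>2 = \<alpha>"
  shows "q \<noteq> 3"
proof
  assume q: "q = 3"
  have "(2::'a) ^ q = 2"
    using cj_2 unfolding cj_def .
  moreover have "2 * (3::'a) = 2 ^ q - 2"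
    unfolding q by simp
  ultimately have "2 * (3::'a) = 0" by simp
  then have three: "(3::'a) = 0"
    using two_nz by (metis mult_eq_0_iff)
  have fixed_cases: "u\<^sup>2 = 1" if "cj u = u" "u \<noteq> 0" for u
  proof -
    have "u ^ q = u" using that(1) unfolding cj_def .
    then show ?thesis
      using that(2) by (simp add: q power3_eq_cube power2_eq_square)
  qed
  have "z \<noteq> 0" using \<alpha> \<alpha>_nz by auto
  then have "(nm z)\<^sup>2 = 1"
    by (intro fixed_cases) auto
  moreover have "nm \<alpha> = (nm z)\<^sup>2"
    unfolding nm_def \<alpha>[symmetric] by (simp add: power_mult_distrib)
  ultimately have "nm \<alpha> = 1" by simp
  then have "d = \<delta>\<^sup>2 + 1 + 3"
    by (simp add: d_def)
  then have d: "d = \<delta>\<^sup>2 + 1"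
    unfolding three by simp
  have "d \<noteq> 1"
    using sq_neq_d[of 1] by simp
  moreover have "(d - 1) * (d + 1) = 0"
    using fixed_cases[OF cj_d d_nz] by algebra
  ultimately have "d + 1 = 0" by simp
  moreover have "(\<delta> - 1) * (\<delta> + 1) = (d + 1) - 3"
    unfolding d by (simp add: algebra_simps power2_eq_square)
  ultimately have "(\<delta> - 1) * (\<delta> + 1) = 0"
    unfolding three by simp
  then have "\<delta> = 1 \<or> \<delta> = - 1"
    by (auto simp: add_eq_0_iff2)
  then have "cj \<delta> = \<delta>"
    by (elim disjE) (simp_all del: cj_\<delta>)
  then have "2 * \<delta> = 0"
    by (metis add.right_inverse cj_\<delta> mult_2)
  with \<open>\<delta> = 1 \<or> \<delta> = - 1\<close> two_nz show False by auto
qed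

lemma ex_four_secant:
  assumes "cj c = - c" "c \<noteq> 0" "z\<^sup>2 = \<alpha>"
  shows "\<exists>s. card (slice c s) = 4"
proof (rule ccontr)
  assume "\<nexists>s. card (slice c s) = 4"
  then have "q + 1 \<le> 4"
    using count_four_secants[OF assms] by simp
  with q_ge3 square_imp_q_neq_3[OF assms(3)] show False by simp
qed

end

section \<open>Homogeneous coordinates\<close>

lemma hc_nth [simp]: "hc x y z $ 1 = x" "hc x y z $ 2 = y" "hc x y z $ 3 = z"
  by (simp_all add: hc_def)

lemma hc_eq_iff [simp]: "hc x y z = hc x' y' z' \<longleftrightarrow> x = x' \<and> y = y' \<and> z = z'"
  by (simp add: vec_eq_iff forall_3)

lemma hc_eq_0_iff [simp]: "hc x y z = 0 \<longleftrightarrow> x = 0 \<and> y = 0 \<and> z = 0"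
  by (simp add: vec_eq_iff forall_3)

lemma hc_cases: obtains x y z where "v = hc x y z"
  by (rule that[of "v $ 1" "v $ 2" "v $ 3"]) (simp add: vec_eq_iff forall_3)

lemma smult_hc [simp]: "k *s hc x y z = hc (k * x) (k * y) (k * z)"
  by (simp add: vec_eq_iff forall_3)

lemma bil_hc [simp]: "bil (hc a b c) (hc x y z) = a * x + b * y + c * z"
  by (simp add: bil_def sum_3)

lemma pt_eq_iff: "pt v = pt w \<longleftrightarrow> (\<exists>k. k \<noteq> 0 \<and> v = k *s w)"
proof
  assume "pt v = pt w"
  moreover have "v \<in> pt v"
    by (auto simp: pt_def intro!: exI[of _ 1])
  ultimately show "\<exists>k. k \<noteq> 0 \<and> v = k *s w"
    by (auto simp: pt_def)
next
  assume "\<exists>k. k \<noteq> 0 \<and> v = k *s w"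
  then obtain k where k: "k \<noteq> 0" "v = k *s w" by blast
  show "pt v = pt w"
  proof (intro equalityI subsetI)
    fix u assume "u \<in> pt v"
    then obtain l where "l \<noteq> 0" "u = l *s v" by (auto simp: pt_def)
    then show "u \<in> pt w"
      using k by (auto simp: pt_def vector_smult_assoc intro!: exI[of _ "l * k"])
  next
    fix u assume "u \<in> pt w"
    then obtain l where "l \<noteq> 0" "u = l *s w" by (auto simp: pt_def)
    then show "u \<in> pt v"
      using k by (auto simp: pt_def vector_smult_assoc intro!: exI[of _ "l / k"])
  qed
qed

lemma pt_in_line_iff:
  assumes "v \<noteq> 0"
  shows "pt v \<in> line u \<longleftrightarrow> bil u v = 0"
proof
  assume "pt v \<in> line u"
  then obtain w where "pt v = pt w" "bil u w = 0"
    by (auto simp: line_def)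
  moreover then obtain k where "v = k *s w"
    by (auto simp: pt_eq_iff)
  ultimately show "bil u v = 0"
    by (simp add: bil_def mult.left_commute flip: sum_distrib_left)
qed (use assms in \<open>auto simp: line_def\<close>)

lemma affine_in_line_iff [simp]:
  "pt (hc x y 1) \<in> line (hc u v w) \<longleftrightarrow> u * x + v * y + w = 0"
  by (simp add: pt_in_line_iff)

lemma vertical_in_line_iff [simp]: "pt (hc 0 1 0) \<in> line (hc u v w) \<longleftrightarrow> v = 0"
  by (simp add: pt_in_line_iff)

lemma pt_affine_eq_iff [simp]: "pt (hc x y 1) = pt (hc x' y' 1) \<longleftrightarrow> x = x' \<and> y = y'"
  by (auto simp: pt_eq_iff)

lemma pt_affine_neq_vertical [simp]:
  "pt (hc x y 1) \<noteq> pt (hc 0 1 0)" "pt (hc 0 1 0) \<noteq> pt (hc x y 1)"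
  by (auto simp: pt_eq_iff)

lemma Lines_cases:
  assumes "L \<in> Lines"
  obtains u v w where "L = line (hc u v w)" "hc u v w \<noteq> 0"
proof -
  obtain n where "L = line n" "n \<noteq> 0"
    using assms by (auto simp: Lines_def)
  moreover obtain u v w where "n = hc u v w" by (rule hc_cases)
  ultimately show thesis using that by blast
qed

lemma line_in_Lines: "u \<noteq> 0 \<Longrightarrow> line u \<in> Lines"
  by (auto simp: Lines_def)

lemma affine_point_cases:
  assumes "P \<in> Points" "P \<notin> l_inf"
  obtains a b where "P = pt (hc a b 1)"
proof -
  obtain v where v: "P = pt v" "v \<noteq> 0"
    using assms(1) by (auto simp: Points_def)
  obtain x y z where xyz: "v = hc x y z" by (rule hc_cases)
  have "z \<noteq> 0"
    using assms(2) v by (auto simp: l_inf_def pt_in_line_iff xyz)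
  then have "P = pt (hc (x / z) (y / z) 1)"
    unfolding v xyz pt_eq_iff by (intro exI[of _ z]) simp
  then show thesis by (rule that)
qed

text \<open>The base is placed on the line \<open>x = 0\<close>, which avoids every vertex of the
  form \<open>(1, m, 0)\<close>.\<close>

lemma baer_pencil_ok_vertical:
  fixes m k :: "'a::field"
  assumes "q > 0"
  shows "baer_pencil_ok q (pt (hc 1 m 0))
    {pt (hc 0 (x + k * y) y) | x y. x \<in> Fq q \<and> y \<in> Fq q \<and> (x, y) \<noteq> (0, 0)}"
    (is "baer_pencil_ok q ?V ?B")
proof -
  define M :: "'a^3^3" where
    "M = vector [vector [0, 0, 1], vector [1, k, 0], vector [0, 1, 0]]"
  have M: "M *v hc x y z = hc z (x + k * y) y" for x y z
    by (simp add: M_def vec_eq_iff forall_3 matrix_vector_mult_def sum_3)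
  have "invertible M"
    by (simp add: invertible_det_nz det_3 M_def)
  moreover have "?B = {pt (M *v hc a b 0) | a b. a \<in> Fq q \<and> b \<in> Fq q \<and> (a, b) \<noteq> (0, 0)}"
    by (simp add: M)
  ultimately have "baer_subline q ?B"
    unfolding baer_subline_def by blast
  moreover have "?V \<in> Points"
    by (auto simp: Points_def)
  moreover have "?V \<notin> L" if "L \<in> Lines" "?B \<subseteq> L" for L
  proof -
    obtain u v w where L: "L = line (hc u v w)" "hc u v w \<noteq> 0"
      using \<open>L \<in> Lines\<close> by (rule Lines_cases)
    \<comment> \<open>These two base points already span \<open>x = 0\<close>, so no other line can
      contain the base.\<close>
    have 1: "pt (hc 0 1 0) \<in> ?B"
      by (rule CollectI, intro exI[of _ 1] exI[of _ 0]) (use assms in \<open>simp add: Fq_def\<close>)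
    have 2: "pt (hc 0 k 1) \<in> ?B"
      by (rule CollectI, intro exI[of _ 0] exI[of _ 1]) (use assms in \<open>simp add: Fq_def\<close>)
    have "pt (hc 0 1 0) \<in> L" "pt (hc 0 k 1) \<in> L"
      by (rule subsetD[OF \<open>?B \<subseteq> L\<close> 1], rule subsetD[OF \<open>?B \<subseteq> L\<close> 2])
    then show ?thesis
      using L by (auto simp: pt_in_line_iff)
  qed
  ultimately show ?thesis
    by (simp add: baer_pencil_ok_def)
qed

section \<open>Feet of an external point\<close>

context buekenhout_metz
begin

abbreviation U :: "('a^3) set set" where
  "U \<equiv> unital_BM q \<alpha> \<beta>"

definition f :: "'a \<Rightarrow> 'a" where
  "f x = \<alpha> * x\<^sup>2 + \<beta> * nm x"

text \<open>The slope of the tangent line at a unital point over \<open>x\<close>, as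
  \<open>pedal_eq\<close> shows; its value at \<open>a\<close> is the common slope of the affine
  pencil lines.\<close>

definition slope :: "'a \<Rightarrow> 'a" where
  "slope x = 2 * \<alpha> * x + \<delta> * cj x"

lemma affine_in_U_iff: "pt (hc x y 1) \<in> U \<longleftrightarrow> cj (y - f x) = y - f x"
proof -
  have "pt (hc x y 1) \<in> U \<longleftrightarrow> (\<exists>r. cj r = r \<and> y = f x + r)"
    by (auto simp: unital_BM_def Fq_iff f_def nm_def cj_def)
  also have "\<dots> \<longleftrightarrow> cj (y - f x) = y - f x"
    by (metis add_diff_cancel_left' add.commute diff_add_cancel)
  finally show ?thesis .
qed

lemma U_cases:
  assumes "Q \<in> U"
  obtains "Q = pt (hc 0 1 0)" | x y where "Q = pt (hc x y 1)"
  using assms by (auto simp: unital_BM_def)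

lemma vertical_in_U: "pt (hc 0 1 0) \<in> U"
  by (simp add: unital_BM_def)

text \<open>Exact second-order expansion of \<open>f\<close> modulo the subfield: the linear part is
  given by \<open>slope x\<close>, the quadratic part by \<open>F\<close>.\<close>

lemma f_add_defect:
  "(m * t - (f (x + t) - f x)) - cj (m * t - (f (x + t) - f x)) =
     ((m - slope x) * t - cj ((m - slope x) * t)) - F t"
  unfolding f_def slope_def F_def nm_def cj_mult cj_diff cj_add cj_power cj_cj cj_\<delta> cj_2
  unfolding \<delta>_def by algebra

lemma affine_in_U_shift_iff:
  assumes "pt (hc x y 1) \<in> U"
  shows "pt (hc (x + t) (y + m * t) 1) \<in> U \<longleftrightarrow>
    (m - slope x) * t - cj ((m - slope x) * t) = F t"
proof -
  have 0: "cj (y - f x) = y - f x"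
    using assms by (simp only: affine_in_U_iff)
  have "y + m * t - f (x + t) = (y - f x) + (m * t - (f (x + t) - f x))"
    by algebra
  then have "(y + m * t - f (x + t)) - cj (y + m * t - f (x + t)) =
      (m * t - (f (x + t) - f x)) - cj (m * t - (f (x + t) - f x))"
    using 0 by (simp only: cj_add) simp
  then show ?thesis
    unfolding affine_in_U_iff f_add_defect by (metis eq_iff_diff_eq_0)
qed

lemma cj_F [simp]: "cj (F x) = - F x"
  by (simp add: F_def)

text \<open>Scaling \<open>t\<close> by a subfield element \<open>l\<close> multiplies the left side
  by \<open>l\<close> and \<open>F\<close> by its square, so a suitable \<open>l\<close> balances
  them. Thus a non-vertical line through an affine unital point with a slope other than the tangent
  one meets the unital again.\<close>

lemma secant_direction:
  assumes "\<mu> \<noteq> 0"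
  shows "\<exists>t. t \<noteq> 0 \<and> \<mu> * t - cj (\<mu> * t) = F t"
proof -
  obtain g where g: "cj g \<noteq> g" using ex_nonfixed by blast
  define t0 where "t0 = g / \<mu>"
  define l where "l = (g - cj g) / F t0"
  have t0: "\<mu> * t0 = g" "t0 \<noteq> 0"
    using assms g by (auto simp: t0_def)
  have "cj l = (cj g - g) / - F t0"
    by (simp add: l_def)
  then have l: "cj l = l" "l \<noteq> 0" "l * F t0 = g - cj g"
    using g t0(2) by (auto simp: l_def minus_divide_divide divide_simps)
  have "F (l * t0) = l * (l * F t0)"
    unfolding F_def nm_def cj_mult l(1) by algebra
  also have "\<dots> = \<mu> * (l * t0) - cj (\<mu> * (l * t0))"
    unfolding l(3) t0(1)[symmetric] cj_mult l(1) by algebra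
  finally show ?thesis
    using l(2) t0(2) by (intro exI[of _ "l * t0"]) simp
qed

end

section \<open>Tangent lines through an external point and their feet\<close>

locale affine_external_point = buekenhout_metz +
  fixes a b
  assumes out: "pt (hc a b 1) \<notin> U"
begin

text \<open>Measures how far the external point is from satisfying the equation of the
  unital.\<close>

definition c where "c = (b - f a) - cj (b - f a)"

lemma cj_c: "cj c = - c"
  by (simp add: c_def)

lemma c_nz: "c \<noteq> 0"
  using out unfolding affine_in_U_iff c_def by simp

text \<open>On the conic this is the point over \<open>a + x\<close> of the line through
  \<open>(a, b, 1)\<close> with slope \<open>slope (a + x)\<close>; the form chosen isolates the
  subfield part \<open>T x\<close>.\<close>

definition foot :: "'a \<Rightarrow> ('a^3) set" where
  "foot x = pt (hc (a + x) (b - c + slope a * x + T x) 1)"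

lemma foot_height:
  assumes "F x = - c"
  shows "b + slope (a + x) * x = b - c + slope a * x + T x"
proof -
  have "slope (a + x) * x = slope a * x + T x + F x"
    unfolding slope_def T_def F_def nm_def cj_add by algebra
  with assms show ?thesis by simp
qed

lemma foot_in_U_iff: "pt (hc (a + x) (b + slope (a + x) * x) 1) \<in> U \<longleftrightarrow> F x = - c"
proof -
  let ?E = "b + slope (a + x) * x - f (a + x)"
  have "?E - cj ?E = c + F x"
    unfolding c_def f_def slope_def F_def nm_def cj_mult cj_diff cj_add cj_power cj_cj cj_\<delta> cj_2
    unfolding \<delta>_def by algebra
  then show ?thesis
    unfolding affine_in_U_iff by (metis add.commute add_eq_0_iff eq_iff_diff_eq_0)
qed

lemma pedal_eq: "pedal U (pt (hc a b 1)) = foot ` {x. F x = - c}"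
proof (intro equalityI subsetI)
  fix Q assume "Q \<in> pedal U (pt (hc a b 1))"
  then obtain L where L: "L \<in> Lines" "pt (hc a b 1) \<in> L" "L \<inter> U = {Q}"
    by (auto simp: pedal_def tangent_line_def)
  obtain u v w where uvw: "L = line (hc u v w)" "hc u v w \<noteq> 0"
    using L(1) by (rule Lines_cases)
  have P: "u * a + v * b + w = 0"
    using L(2) uvw by simp
  have "v \<noteq> 0"
  proof
    assume v: "v = 0"
    \<comment> \<open>A vertical line is not tangent: besides \<open>(0, 1, 0)\<close> it contains
      an affine unital point.\<close>
    have "pt (hc a (f a) 1) \<in> L \<inter> U" "pt (hc 0 1 0) \<in> L \<inter> U"
      using P v uvw by (simp_all add: affine_in_U_iff vertical_in_U)
    with L(3) show False
      by (metis pt_affine_neq_vertical(1) singletonD)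
  qed
  define m where "m = - u / v"
  have on_L: "pt (hc x y 1) \<in> L \<longleftrightarrow> y = b + m * (x - a)" for x y
  proof -
    have "v * m = - u"
      using \<open>v \<noteq> 0\<close> by (simp add: m_def)
    then have "u * x + v * y + w = v * (y - (b + m * (x - a)))"
      using P by algebra
    then show ?thesis
      using \<open>v \<noteq> 0\<close> by (simp add: uvw)
  qed
  have Q: "Q \<in> L" "Q \<in> U" using L(3) by auto
  moreover have "pt (hc 0 1 0) \<notin> L"
    using \<open>v \<noteq> 0\<close> uvw by simp
  ultimately obtain x0 y0 where xy: "Q = pt (hc x0 y0 1)"
    by (metis U_cases)
  have y0: "y0 = b + m * (x0 - a)"
    using Q(1) xy on_L by simp
  have QU: "pt (hc x0 y0 1) \<in> U" using Q xy by simp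
  have "m = slope x0"
  proof (rule ccontr)
    assume "m \<noteq> slope x0"
    then obtain t where t: "t \<noteq> 0" "(m - slope x0) * t - cj ((m - slope x0) * t) = F t"
      using secant_direction[of "m - slope x0"] by auto
    then have "pt (hc (x0 + t) (y0 + m * t) 1) \<in> U"
      using affine_in_U_shift_iff[OF QU] by blast
    moreover have "pt (hc (x0 + t) (y0 + m * t) 1) \<in> L"
      unfolding on_L y0 by algebra
    ultimately have "pt (hc (x0 + t) (y0 + m * t) 1) = Q"
      using L(3) by blast
    with t(1) show False by (simp add: xy)
  qed
  define x where "x = x0 - a"
  have x: "x0 = a + x" "y0 = b + slope (a + x) * x"
    using y0 \<open>m = slope x0\<close> by (simp_all add: x_def)
  have "F x = - c"
    using QU foot_in_U_iff unfolding x by blast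
  then show "Q \<in> foot ` {x. F x = - c}"
    using foot_height xy x by (auto simp: foot_def)
next
  fix Q assume "Q \<in> foot ` {x. F x = - c}"
  then obtain x where x: "F x = - c" "Q = foot x" by blast
  define m where "m = slope (a + x)"
  define L where "L = line (hc m (-1) (b - m * a))"
  have on_L: "pt (hc x' y' 1) \<in> L \<longleftrightarrow> y' = b + m * (x' - a)" for x' y'
    unfolding L_def affine_in_line_iff by (auto simp: algebra_simps)
  have Q: "Q = pt (hc (a + x) (b + m * x) 1)"
    using foot_height[OF x(1)] x(2) by (simp add: foot_def m_def)
  have QU: "Q \<in> U"
    using x(1) foot_in_U_iff by (simp add: Q m_def)
  have "Q' = Q" if "Q' \<in> L" "Q' \<in> U" for Q'
  proof -
    obtain x' y' where Q': "Q' = pt (hc x' y' 1)"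
      using \<open>Q' \<in> U\<close> by (rule U_cases) (use \<open>Q' \<in> L\<close> in \<open>auto simp: L_def\<close>)
    define t where "t = x' - (a + x)"
    have x': "x' = a + x + t" "y' = b + m * x + m * t"
      using \<open>Q' \<in> L\<close> unfolding Q' on_L t_def by (auto simp: algebra_simps)
    \<comment> \<open>Along the tangent slope the linear part vanishes, so anisotropy of
      \<open>F\<close> leaves only the foot itself.\<close>
    have "F t = 0"
      using affine_in_U_shift_iff[OF QU[unfolded Q], of t m] \<open>Q' \<in> U\<close>
      by (simp add: Q' x' m_def)
    then show ?thesis
      by (simp add: Q Q' x')
  qed
  moreover have "Q \<in> L"
    unfolding Q on_L by simp
  ultimately have "L \<inter> U = {Q}"
    using QU by blast
  moreover have "L \<in> Lines"
    by (simp add: L_def line_in_Lines)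
  moreover have "pt (hc a b 1) \<in> L"
    unfolding on_L by simp
  ultimately show "Q \<in> pedal U (pt (hc a b 1))"
    by (auto simp: pedal_def tangent_line_def)
qed

section \<open>Intersections of lines with the pedal\<close>

abbreviation K :: "('a^3) set set" where
  "K \<equiv> pedal U (pt (hc a b 1))"

abbreviation V :: "('a^3) set" where
  "V \<equiv> pt (hc 1 (slope a) 0)"

lemma inj_foot: "inj_on foot A"
  by (auto simp: inj_on_def foot_def)

lemma card_line_pedal:
  "card (line (hc u v w) \<inter> K) =
    card {x. F x = - c \<and> u * (a + x) + v * (b - c + slope a * x + T x) + w = 0}"
proof -
  have "line (hc u v w) \<inter> K =
      foot ` {x. F x = - c \<and> u * (a + x) + v * (b - c + slope a * x + T x) + w = 0}"
    unfolding pedal_eq by (auto simp: foot_def)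
  then show ?thesis
    by (simp add: card_image inj_foot)
qed

lemma card_line_le_2:
  assumes "L \<in> Lines" "V \<notin> L"
  shows "card (L \<inter> K) \<le> 2"
proof -
  obtain u v w where L: "L = line (hc u v w)" "hc u v w \<noteq> 0"
    using assms(1) by (rule Lines_cases)
  have nz: "u + v * slope a \<noteq> 0"
    using assms(2) by (simp add: L pt_in_line_iff)
  let ?S = "{x. F x = - c \<and> u * (a + x) + v * (b - c + slope a * x + T x) + w = 0}"
  have "card ?S \<le> 2"
  proof (cases "v = 0")
    case True
    then have "?S \<subseteq> {- w / u - a}"
      using nz by (auto simp: field_simps add_eq_0_iff)
    then have "card ?S \<le> card {- w / u - a}"
      by (intro card_mono) auto
    then show ?thesis by simp
  next
    case False
    \<comment> \<open>The line equation solved for \<open>T x\<close> reads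
      \<open>T x = \<mu> * x + k\<close>, which forces the right side into the subfield;
      \<open>\<mu>\<close> is nonzero because \<open>V\<close> is not on the line.\<close>
    define \<mu> where "\<mu> = - (u + v * slope a) / v"
    define k where "k = - (u * a + v * (b - c) + w) / v"
    have "cj (\<mu> * x + k) = \<mu> * x + k"
      if "u * (a + x) + v * (b - c + slope a * x + T x) + w = 0" for x
    proof -
      have "v * T x = v * (\<mu> * x + k)"
        using that False by (simp add: \<mu>_def k_def field_simps add_eq_0_iff2) algebra
      then have "\<mu> * x + k = T x" using False by simp
      then show ?thesis by simp
    qed
    then have "card ?S \<le> card {x. F x = - c \<and> cj (\<mu> * x + k) = \<mu> * x + k}"
      by (intro card_mono) auto
    also have "\<dots> \<le> 2"
      by (rule card_conic_affine_line_le) (unfold \<mu>_def, metis nz False divide_eq_0_iff neg_equal_0_iff_equal)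
    finally show ?thesis .
  qed
  then show ?thesis
    by (simp add: L card_line_pedal)
qed

definition pencil_line :: "'a \<Rightarrow> ('a^3) set set" where
  "pencil_line s = line (hc (slope a) (- 1) (b - c - slope a * a + s))"

lemma pencil_line:
  "pencil_line s \<in> Lines" "V \<in> pencil_line s" "card (pencil_line s \<inter> K) = card (slice c s)"
proof -
  show "pencil_line s \<in> Lines" "V \<in> pencil_line s"
    by (simp_all add: pencil_line_def line_in_Lines pt_in_line_iff)
  show "card (pencil_line s \<inter> K) = card (slice c s)"
    unfolding pencil_line_def card_line_pedal slice_def
    by (rule arg_cong[where f = card]) (auto simp: algebra_simps)
qed

lemma inj_pencil_line: "inj pencil_line"
proof (rule injI)
  fix s s' assume eq: "pencil_line s = pencil_line s'"
  have "pt (hc 0 (b - c - slope a * a + s) 1) \<in> pencil_line s"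
    by (simp add: pencil_line_def)
  then show "s = s'"
    unfolding eq by (simp add: pencil_line_def)
qed

lemma card_line_through_V:
  assumes "L \<in> Lines" "V \<in> L"
  shows "card (L \<inter> K) = 0 \<or> (\<exists>s. card (L \<inter> K) = card (slice c s))"
proof -
  obtain u v w where L: "L = line (hc u v w)" "hc u v w \<noteq> 0"
    using assms(1) by (rule Lines_cases)
  have u: "u = - v * slope a"
    using assms(2) by (simp add: L pt_in_line_iff add_eq_0_iff2)
  let ?S = "{x. F x = - c \<and> u * (a + x) + v * (b - c + slope a * x + T x) + w = 0}"
  show ?thesis
  proof (cases "v = 0")
    case True
    \<comment> \<open>Here the line is the line at infinity, which contains no feet.\<close>
    with u L(2) have "?S = {}" by simp
    then show ?thesis
      by (simp add: L card_line_pedal del: Collect_empty_eq)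
  next
    case False
    define s where "s = slope a * a - (b - c) - w / v"
    have "u * (a + x) + v * (b - c + slope a * x + T x) + w = v * (T x - s)" for x
      using False unfolding u s_def by (simp add: field_simps)
    then have "?S = slice c s"
      using False by (simp add: slice_def)
    then show ?thesis
      by (auto simp: L card_line_pedal)
  qed
qed

text \<open>The intersections of the lines \<open>pencil_line s\<close>, for \<open>s\<close> in the
  subfield, with \<open>x = 0\<close>, completed by \<open>(0, 1, 0)\<close>.\<close>

abbreviation B :: "('a^3) set set" where
  "B \<equiv> {pt (hc 0 (x + (b - c - slope a * a) * y) y) | x y. x \<in> Fq q \<and> y \<in> Fq q \<and> (x, y) \<noteq> (0, 0)}"

lemma pedal_subset_pencil: "K \<subseteq> \<Union> (pencil_lines V B)"
proof
  fix Q assume "Q \<in> K"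
  then obtain x where Q: "Q = foot x"
    unfolding pedal_eq by blast
  have "Q \<in> pencil_line (T x)"
    by (simp add: Q foot_def pencil_line_def algebra_simps)
  moreover have "pt (hc 0 (T x + (b - c - slope a * a) * 1) 1) \<in> B"
    by (rule CollectI, intro exI[of _ "T x"] exI[of _ 1]) (simp add: Fq_iff)
  moreover have "pt (hc 0 (T x + (b - c - slope a * a) * 1) 1) \<in> pencil_line (T x)"
    by (simp add: pencil_line_def)
  ultimately show "Q \<in> \<Union> (pencil_lines V B)"
    using pencil_line unfolding pencil_lines_def by blast
qed

lemma nonsquare_arc:
  assumes "\<nexists>z. z\<^sup>2 = \<alpha>"
  shows "is_arc K"
proof -
  have "card (L \<inter> K) \<in> {0, 1, 2}" if "L \<in> Lines" for L
  proof (cases "V \<in> L")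
    case True
    then show ?thesis
      using card_line_through_V[OF that] card_slice_nonsquare[OF cj_c c_nz assms] by (metis insertCI)
  next
    case False
    then show ?thesis
      using card_line_le_2[OF that] by force
  qed
  then show ?thesis
    by (simp add: is_arc_def of_type_def)
qed

lemma four_secant_through_V:
  assumes "L \<in> Lines" "card (L \<inter> K) = 4"
  shows "V \<in> L"
  using card_line_le_2[OF assms(1)] assms(2) by force

lemma card_K: "card K = q + 1"
  unfolding pedal_eq using card_conic[OF cj_c c_nz] by (simp add: card_image inj_foot)

text \<open>Size zero occurs on the line at infinity, one on a tangent line at a foot, four by
  \<open>ex_four_secant\<close>, and two on the join of feet from different pencil lines.\<close>

lemma square_class:
  assumes \<alpha>: "z\<^sup>2 = \<alpha>"
  shows "of_class K {0, 1, 2, 4}"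
proof -
  have "card (L \<inter> K) \<in> {0, 1, 2, 4}" if "L \<in> Lines" for L
  proof (cases "V \<in> L")
    case True
    then show ?thesis
      using card_line_through_V[OF that] card_slice_square[OF cj_c c_nz \<alpha>] by (metis insertCI)
  next
    case False
    then show ?thesis
      using card_line_le_2[OF that] by force
  qed
  moreover have "\<exists>L\<in>Lines. card (L \<inter> K) = 0"
  proof
    show "card (line (hc 0 0 1) \<inter> K) = 0"
      unfolding card_line_pedal by simp
  qed (simp add: line_in_Lines)
  moreover obtain s where s: "card (slice c s) = 4"
    using ex_four_secant[OF cj_c c_nz \<alpha>] by blast
  then have four: "\<exists>L\<in>Lines. card (L \<inter> K) = 4"
    using pencil_line[of s] by metis
  moreover have "\<exists>L\<in>Lines. card (L \<inter> K) = 1"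
  proof -
    obtain Q where "Q \<in> K"
      using card_K by fastforce
    then obtain L where L: "L \<in> Lines" "L \<inter> U = {Q}"
      by (auto simp: pedal_def tangent_line_def)
    moreover have "K \<subseteq> U"
      by (auto simp: pedal_def)
    ultimately have "L \<inter> K = {Q}"
      using \<open>Q \<in> K\<close> by blast
    with L(1) show ?thesis
      by (intro bexI[of _ L]) auto
  qed
  moreover have "\<exists>L\<in>Lines. card (L \<inter> K) = 2"
  proof -
    \<comment> \<open>As \<open>q\<close> is not three, there are more than four feet, so some foot
      lies off the chosen four-point pencil line.\<close>
    have "card (slice c s) < card {x. F x = - c}"
      using s q_ge3 square_imp_q_neq_3[OF \<alpha>] card_conic[OF cj_c c_nz] by simp
    then have "\<not> {x. F x = - c} \<subseteq> slice c s"
      using card_mono[OF finite, of "{x. F x = - c}" "slice c s"] by linarith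
    then obtain y where y: "F y = - c" "T y \<noteq> s"
      by (auto simp: slice_def)
    have "\<not> slice c s \<subseteq> {y}"
      using s card_mono[of "{y}" "slice c s"] by auto
    then obtain x where x: "F x = - c" "T x = s" "x \<noteq> y"
      by (auto simp: slice_def)
    \<comment> \<open>The excess of the slope of the join over \<open>slope a\<close>; it is nonzero
      since the traces differ, which keeps \<open>V\<close> off the join.\<close>
    define k where "k = (T y - T x) / (y - x)"
    define m where "m = slope a + k"
    define L where "L = line (hc m (- 1) (b - c + slope a * x + T x - m * (a + x)))"
    have "k * (y - x) = T y - T x"
      using x(3) by (simp add: k_def)
    then have "m * (y - x) = slope a * (y - x) + (T y - T x)"
      unfolding m_def by algebra
    then have "foot y \<in> L"
      unfolding foot_def L_def affine_in_line_iff by algebra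
    moreover have "foot x \<in> L"
      by (simp add: foot_def L_def)
    moreover have "foot x \<in> K" "foot y \<in> K"
      unfolding pedal_eq using x y by auto
    ultimately have "card {foot x, foot y} \<le> card (L \<inter> K)"
      by (intro card_mono) auto
    moreover have "foot x \<noteq> foot y"
      using x(3) by (simp add: foot_def)
    moreover have "L \<in> Lines"
      by (simp add: L_def line_in_Lines)
    moreover have "V \<notin> L"
      using x(2,3) y(2) by (simp add: L_def pt_in_line_iff m_def k_def)
    ultimately show ?thesis
      using card_line_le_2[of L] by (intro bexI[of _ L]) auto
  qed
  ultimately show ?thesis
    by (simp add: of_class_def of_type_def)
qed

lemma card_four_secants:
  assumes "z\<^sup>2 = \<alpha>"
  shows "q + 1 \<le> 4 * card {L \<in> Lines. card (L \<inter> K) = 4} + 4"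
proof -
  have "card {s. card (slice c s) = 4} = card (pencil_line ` {s. card (slice c s) = 4})"
    using card_image[OF inj_on_subset[OF inj_pencil_line subset_UNIV], of "{s. card (slice c s) = 4}"] by simp
  also have "\<dots> \<le> card {L \<in> Lines. card (L \<inter> K) = 4}"
    by (rule card_mono) (auto simp: pencil_line)
  finally show ?thesis
    using count_four_secants[OF cj_c c_nz assms] by simp
qed

end

theorem theorem1p5:
  fixes q :: nat and \<alpha> \<beta> :: "'a::{finite,field}" and P :: "('a^3) set"
  assumes q_pp: "\<exists>p k. prime p \<and> k > 0 \<and> q = p ^ k"
    and q_odd: "odd q"
    and card_field: "CARD('a) = q ^ 2"
    and \<alpha>_nz: "\<alpha> \<noteq> 0"
    and d_nonsq: "\<not> (\<exists>y\<in>Fq q. y ^ 2 = (\<beta> ^ q - \<beta>) ^ 2 + 4 * \<alpha> ^ (q + 1))"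
    and P_pt: "P \<in> Points"
    and P_out: "P \<notin> unital_BM q \<alpha> \<beta> \<union> l_inf"
  shows "\<exists>V B. V \<in> l_inf \<and> baer_pencil_ok q V B \<and>
           pedal (unital_BM q \<alpha> \<beta>) P \<subseteq> \<Union> (pencil_lines V B) \<and>
           ((\<not> (\<exists>y. y ^ 2 = \<alpha>)) \<longrightarrow> is_arc (pedal (unital_BM q \<alpha> \<beta>) P)) \<and>
           ((\<exists>y. y ^ 2 = \<alpha>) \<longrightarrow>
              of_class (pedal (unital_BM q \<alpha> \<beta>) P) {0, 1, 2, 4} \<and>
              real (card {L\<in>Lines. card (L \<inter> pedal (unital_BM q \<alpha> \<beta>) P) = 4})
                \<ge> (real q - 3) / 4 \<and>
              (\<forall>L\<in>Lines. card (L \<inter> pedal (unital_BM q \<alpha> \<beta>) P) = 4 \<longrightarrow> V \<in> L))"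
proof -
  obtain a b where P: "P = pt (hc a b 1)"
    using affine_point_cases P_pt P_out by blast
  interpret affine_external_point q \<alpha> \<beta> a b
    by unfold_locales (use assms P in auto)
  have "(real q - 3) / 4 \<le> real (card {L \<in> Lines. card (L \<inter> K) = 4})" if "\<exists>y. y\<^sup>2 = \<alpha>"
    using card_four_secants that by fastforce
  moreover have "V \<in> l_inf"
    by (simp add: l_inf_def pt_in_line_iff)
  moreover have "baer_pencil_ok q V B"
    by (rule baer_pencil_ok_vertical) (use q_ge3 in simp)
  ultimately show ?thesis
    unfolding P
    using pedal_subset_pencil nonsquare_arc square_class four_secant_through_V
    by (intro exI[of _ V] exI[of _ B]) blast
qed

end
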